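(* Let $\mathcal{R}$ be a field, let $q\ge 1$ be an integer, and fix any monomial order on $\mathcal{R}[x]^q$. Let $M$ be a nonzero submodule of $\mathcal{R}[x]^q$ and let $G$ be a minimal Gröbner basis of $M$. Then $G$ has the Predictable Leading Monomial (PLM) property. In particular, $G$ is a basis of the $\mathcal{R}[x]$-module $M$.
   Context: Let $\mathrm{e}_1,\dots,\mathrm{e}_q$ be the unit vectors in $\mathcal{R}^q$. Monomials of $\mathcal{R}[x]^q$ are the elements $x^\alpha \mathrm{e}_i$ with $\alpha\in\mathbb{N}_0$, $1\le i\le q$. A monomial order is a total order on the monomials such that $X<x^{\gamma}X$ for every monomial $X$ and every $\gamma\ge1$, and $X<Y$ implies $x^\gamma X<x^\gamma Y$ for all $\gamma\ge 0$. Examples are TOP (Term Over Position): $x^\alpha \mathrm{e}_i<x^\beta \mathrm{e}_j$ iff $\alpha<\beta$ or ($\alpha=\beta$ and $i>j$); and POT (Position Over Term): $x^\alpha \mathrm{e}_i<x^\beta \mathrm{e}_j$ iff $i>j$ or ($i=j$ and $\alpha<\beta$). Every nonzero $f\in\mathcal{R}[x]^q$ is uniquely $f=\sum_{i=1}^L c_iX_i$ with nonzero $c_i\in\mathcal{R}$ and monomials $X_1>\dots>X_L$. Put $\mathrm{lm}(f)=X_1$ (leading monomial) and $\mathrm{lt}(f)=c_1X_1$ (leading term). For a nonzero polynomial $a\in\mathcal{R}[x]$, $\mathrm{lm}(a)=x^{\deg a}$. For a set $F$ of nonzero vectors, $\mathrm{L}(F)$ denotes the submodule generated by $\{\mathrm{lt}(f):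 f\in F\}$, and $\mathrm{L}(M)$ is the submodule generated by the leading terms of all nonzero elements of $M$. A finite set $G\subseteq M$ of nonzero vectors is a Gröbner basis of $M$ if $\mathrm{L}(G)=\mathrm{L}(M)$. A nonzero $f$ can be reduced modulo a set $F$ of nonzero vectors if there are $f_1,\dots,f_s\in F$ ($s\ge1$), $\alpha_1,\dots,\alpha_s\in\mathbb{N}_0$ and $c_1,\dots,c_s\in\mathcal{R}$ with $\mathrm{lm}(f)=x^{\alpha_i}\mathrm{lm}(f_i)$ for all $i$ and $\mathrm{lt}(f)=\sum_{i=1}^s c_ix^{\alpha_i}\mathrm{lt}(f_i)$; otherwise $f$ is minimal with respect to $F$. A Gröbner basis $G$ is minimal if each $g\in G$ is minimal with respect to $G\setminus\{g\}$. PLM property: a nonempty finite subset $F=\{f_1,\dots,f_s\}$ of $M$ has the PLM property if for any $0\ne f\in M$ and any expression $f=a_1f_1+\dots+a_sf_s$ with $a_1,\dots,a_s\in\mathcal{R}[x]$ one has $\mathrm{lm}(f)=\max_{1\le i\le s;\,a_i\ne0}\bigl(\mathrm{lm}(a_i)\,\mathrm{lm}(f_i)\bigr)$. *)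

theory Defs
  imports "HOL-Analysis.Finite_Cartesian_Product" "HOL-Computational_Algebra.Polynomial"
begin

text \<open>
  The module \<open>R[x]\<^sup>q\<close> is the type \<open>'a poly ^ 'q\<close> with scalar multiplication \<open>(*s)\<close>. The
  positions \<open>1, \<dots>, q\<close> are the elements of the finite index type \<open>'q\<close>; no order on \<open>'q\<close> is
  needed, since positions are compared only through a monomial order.
\<close>

lemma module_poly_vec: "module ((*s) :: 'a::comm_ring_1 poly \<Rightarrow> 'a poly ^ 'q \<Rightarrow> 'a poly ^ 'q)"
  by unfold_locales (simp_all add: vec_eq_iff algebra_simps)

text \<open>The monomial \<open>x\<^sup>\<alpha> e\<^sub>i\<close>.\<close>

definition vmonom :: "nat \<Rightarrow> 'q \<Rightarrow> 'a::comm_ring_1 poly ^ 'q" where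
  "vmonom \<alpha> i = monom 1 \<alpha> *s axis i 1"

definition monomials :: "('a::comm_ring_1 poly ^ 'q) set" where
  "monomials = {vmonom \<alpha> i | \<alpha> i. True}"

text \<open>\<open>prec\<close> is a strict order; its values outside \<open>monomials\<close> are irrelevant.\<close>

definition monomial_order ::
    "('a::comm_ring_1 poly ^ 'q \<Rightarrow> 'a poly ^ 'q \<Rightarrow> bool) \<Rightarrow> bool" where
  "monomial_order prec \<longleftrightarrow>
     irreflp_on monomials prec \<and> transp_on monomials prec \<and> totalp_on monomials prec \<and>
     (\<forall>X\<in>monomials. \<forall>\<gamma>\<ge>1. prec X (monom 1 \<gamma> *s X)) \<and>
     (\<forall>X\<in>monomials. \<forall>Y\<in>monomials. prec X Y \<longrightarrow> (\<forall>\<gamma>. prec (monom 1 \<gamma> *s X) (monom 1 \<gamma> *s Y)))"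

definition is_max :: "('b \<Rightarrow> 'b \<Rightarrow> bool) \<Rightarrow> 'b set \<Rightarrow> 'b \<Rightarrow> bool" where
  "is_max prec S X \<longleftrightarrow> X \<in> S \<and> (\<forall>Y\<in>S. Y \<noteq> X \<longrightarrow> prec Y X)"

text \<open>
  \<open>monomial_expansion f c\<close>: \<open>f\<close> is the finite linear combination of monomials in which \<open>X\<close> has
  coefficient \<open>c X\<close>.
\<close>

definition monomial_expansion ::
    "'a::comm_ring_1 poly ^ 'q \<Rightarrow> ('a poly ^ 'q \<Rightarrow> 'a) \<Rightarrow> bool" where
  "monomial_expansion f c \<longleftrightarrow>
     finite {X. c X \<noteq> 0} \<and> {X. c X \<noteq> 0} \<subseteq> monomials \<and> f = (\<Sum>X | c X \<noteq> 0. [:c X:] *s X)"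

definition monomial_coeff :: "'a::comm_ring_1 poly ^ 'q \<Rightarrow> 'a poly ^ 'q \<Rightarrow> 'a" where
  "monomial_coeff f = (THE c. monomial_expansion f c)"

lemma coeff_vmonom: "coeff (vmonom \<beta> j $ i) \<alpha> = (if \<alpha> = \<beta> \<and> i = j then 1 else 0)"
  by (auto simp: vmonom_def axis_def)

lemma vmonom_eq_iff [simp]:
  "(vmonom \<alpha> i :: 'a::comm_ring_1 poly ^ 'q) = vmonom \<beta> j \<longleftrightarrow> \<alpha> = \<beta> \<and> i = j"
proof
  assume "(vmonom \<alpha> i :: 'a poly ^ 'q) = vmonom \<beta> j"
  then have "coeff ((vmonom \<alpha> i :: 'a poly ^ 'q) $ i) \<alpha> = coeff ((vmonom \<beta> j :: 'a poly ^ 'q) $ i) \<alpha>"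
    by simp
  then show "\<alpha> = \<beta> \<and> i = j" by (auto simp: coeff_vmonom split: if_splits)
qed simp

lemma monomial_expansion_coeff:
  fixes f :: "'a::comm_ring_1 poly ^ 'q"
  assumes "monomial_expansion f c"
  shows "c (vmonom \<alpha> i) = coeff (f $ i) \<alpha>"
proof -
  let ?S = "{X. c X \<noteq> 0}"
  have fin: "finite ?S" and sub: "?S \<subseteq> monomials" and f: "f = (\<Sum>X\<in>?S. [:c X:] *s X)"
    using assms by (auto simp: monomial_expansion_def)
  have "coeff (f $ i) \<alpha> = (\<Sum>X\<in>?S. c X * coeff (X $ i) \<alpha>)"
    by (subst f) (simp add: coeff_sum)
  also have "\<dots> = (\<Sum>X\<in>?S. if X = vmonom \<alpha> i then c X else 0)"
  proof (rule sum.cong[OF refl])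
    fix X assume "X \<in> ?S"
    then obtain \<beta> j where "X = vmonom \<beta> j" using sub by (auto simp: monomials_def)
    then show "c X * coeff (X $ i) \<alpha> = (if X = vmonom \<alpha> i then c X else 0)"
      by (auto simp: coeff_vmonom)
  qed
  also have "\<dots> = c (vmonom \<alpha> i)"
    using fin by (simp add: sum.delta)
  finally show ?thesis by simp
qed

lemma monomial_expansion_unique:
  fixes f :: "'a::comm_ring_1 poly ^ 'q"
  shows "\<exists>!c. monomial_expansion f c"
proof (rule ex_ex1I)
  let ?v = "\<lambda>p. vmonom (fst p) (snd p) :: 'a poly ^ 'q"
  let ?P = "{p. coeff (f $ snd p) (fst p) \<noteq> 0}"
  define c where "c X = (if X \<in> monomials then
      (THE a. \<exists>\<alpha> i. X = vmonom \<alpha> i \<and> a = coeff (f $ i) \<alpha>) else 0)" for X :: "'a poly ^ 'q"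
  have c: "c (vmonom \<alpha> i) = coeff (f $ i) \<alpha>" for \<alpha> i
    by (auto simp: c_def monomials_def)
  have S: "{X. c X \<noteq> 0} = ?v ` ?P"
  proof (intro set_eqI iffI)
    fix X assume X: "X \<in> {X. c X \<noteq> 0}"
    then have "X \<in> monomials" by (auto simp: c_def split: if_splits)
    then obtain \<alpha> i where "X = vmonom \<alpha> i" by (auto simp: monomials_def)
    then show "X \<in> ?v ` ?P" using X c by (intro image_eqI[of _ _ "(\<alpha>, i)"]) auto
  qed (auto simp: c)
  have "?P \<subseteq> (SIGMA \<alpha>:(\<Union>i. {..degree (f $ i)}). UNIV)"
    using le_degree by fastforce
  then have fP: "finite ?P" by (rule finite_subset) auto
  have inj: "inj_on ?v ?P" by (auto simp: inj_on_def prod_eq_iff)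
  have "f = (\<Sum>X\<in>?v ` ?P. [:c X:] *s X)"
    unfolding sum.reindex[OF inj]
  proof (simp add: vec_eq_iff poly_eq_iff coeff_sum coeff_vmonom c, intro allI)
    fix i \<alpha>
    have "(\<Sum>p\<in>?P. coeff (f $ snd p) (fst p) * (if \<alpha> = fst p \<and> i = snd p then 1 else 0))
        = (\<Sum>p\<in>?P. if p = (\<alpha>, i) then coeff (f $ i) \<alpha> else 0)"
      by (rule sum.cong) (auto simp: prod_eq_iff)
    also have "\<dots> = coeff (f $ i) \<alpha>" using fP by (simp add: sum.delta)
    finally show "coeff (f $ i) \<alpha> =
        (\<Sum>p\<in>?P. coeff (f $ snd p) (fst p) * (if \<alpha> = fst p \<and> i = snd p then 1 else 0))" by simp
  qed
  then have "monomial_expansion f c"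
    unfolding monomial_expansion_def S using fP by (auto simp: monomials_def)
  then show "\<exists>c. monomial_expansion f c" by blast
next
  fix c d assume cd: "monomial_expansion f c" "monomial_expansion f d"
  show "c = d"
  proof
    fix X show "c X = d X"
    proof (cases "X \<in> monomials")
      case True
      then show ?thesis
        using cd[THEN monomial_expansion_coeff] by (auto simp: monomials_def)
    next
      case False
      then have "c X = 0" "d X = 0" using cd by (auto simp: monomial_expansion_def)
      then show ?thesis by simp
    qed
  qed
qed

lemma monomial_coeff_vmonom: "monomial_coeff f (vmonom \<alpha> i) = coeff (f $ i) \<alpha>"
  unfolding monomial_coeff_def
  by (rule monomial_expansion_coeff[OF theI'[OF monomial_expansion_unique]])

text \<open>Leading monomial and leading term; meaningful for \<open>f \<noteq> 0\<close> only.\<close>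

definition lm ::
    "('a::comm_ring_1 poly ^ 'q \<Rightarrow> 'a poly ^ 'q \<Rightarrow> bool) \<Rightarrow> 'a poly ^ 'q \<Rightarrow> 'a poly ^ 'q" where
  "lm prec f = (THE X. is_max prec {X. monomial_coeff f X \<noteq> 0} X)"

definition lt ::
    "('a::comm_ring_1 poly ^ 'q \<Rightarrow> 'a poly ^ 'q \<Rightarrow> bool) \<Rightarrow> 'a poly ^ 'q \<Rightarrow> 'a poly ^ 'q" where
  "lt prec f = [:monomial_coeff f (lm prec f):] *s lm prec f"

definition poly_lm :: "'a::comm_ring_1 poly \<Rightarrow> 'a poly" where
  "poly_lm a = monom 1 (degree a)"

text \<open>
  Both \<open>L(F)\<close> and \<open>L(M)\<close>: zero vectors are dropped, so that for a submodule \<open>M\<close> this is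
  generated by the leading terms of the nonzero elements of \<open>M\<close>.
\<close>

definition lt_module ::
    "('a::comm_ring_1 poly ^ 'q \<Rightarrow> 'a poly ^ 'q \<Rightarrow> bool) \<Rightarrow> ('a poly ^ 'q) set \<Rightarrow> ('a poly ^ 'q) set" where
  "lt_module prec F = module.span (*s) (lt prec ` (F - {0}))"

definition groebner_basis ::
    "('a::comm_ring_1 poly ^ 'q \<Rightarrow> 'a poly ^ 'q \<Rightarrow> bool) \<Rightarrow> ('a poly ^ 'q) set \<Rightarrow> ('a poly ^ 'q) set \<Rightarrow> bool" where
  "groebner_basis prec M G \<longleftrightarrow>
     finite G \<and> G \<subseteq> M \<and> 0 \<notin> G \<and> lt_module prec G = lt_module prec M"

definition reducible_modulo ::
    "('a::comm_ring_1 poly ^ 'q \<Rightarrow> 'a poly ^ 'q \<Rightarrow> bool) \<Rightarrow> ('a poly ^ 'q) set \<Rightarrow> 'a poly ^ 'q \<Rightarrow> bool" where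
  "reducible_modulo prec F f \<longleftrightarrow>
     (\<exists>s::nat. \<exists>fs \<alpha> c. s \<ge> 1 \<and>
        (\<forall>i\<in>{1..s}. fs i \<in> F \<and> lm prec f = monom 1 (\<alpha> i) *s lm prec (fs i)) \<and>
        lt prec f = (\<Sum>i=1..s. ([:c i:] * monom 1 (\<alpha> i)) *s lt prec (fs i)))"

definition minimal_wrt ::
    "('a::comm_ring_1 poly ^ 'q \<Rightarrow> 'a poly ^ 'q \<Rightarrow> bool) \<Rightarrow> ('a poly ^ 'q) set \<Rightarrow> 'a poly ^ 'q \<Rightarrow> bool" where
  "minimal_wrt prec F f \<longleftrightarrow> \<not> reducible_modulo prec F f"

definition minimal_groebner_basis ::
    "('a::comm_ring_1 poly ^ 'q \<Rightarrow> 'a poly ^ 'q \<Rightarrow> bool) \<Rightarrow> ('a poly ^ 'q) set \<Rightarrow> ('a poly ^ 'q) set \<Rightarrow> bool" where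
  "minimal_groebner_basis prec M G \<longleftrightarrow>
     groebner_basis prec M G \<and> (\<forall>g\<in>G. minimal_wrt prec (G - {g}) g)"

text \<open>
  The Predictable Leading Monomial property. \<open>0 \<notin> F\<close> is implicit in the use of \<open>lm prec g\<close> for
  \<open>g \<in> F\<close>. The coefficients are indexed by the elements of \<open>F\<close>.
\<close>

definition plm_property ::
    "('a::comm_ring_1 poly ^ 'q \<Rightarrow> 'a poly ^ 'q \<Rightarrow> bool) \<Rightarrow> ('a poly ^ 'q) set \<Rightarrow> ('a poly ^ 'q) set \<Rightarrow> bool" where
  "plm_property prec M F \<longleftrightarrow>
     finite F \<and> F \<noteq> {} \<and> F \<subseteq> M \<and> 0 \<notin> F \<and>
     (\<forall>f\<in>M. \<forall>a. f \<noteq> 0 \<and> f = (\<Sum>g\<in>F. a g *s g) \<longrightarrow>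
        is_max prec {poly_lm (a g) *s lm prec g | g. g \<in> F \<and> a g \<noteq> 0} (lm prec f))"

definition module_basis :: "('a::comm_ring_1 poly ^ 'q) set \<Rightarrow> ('a poly ^ 'q) set \<Rightarrow> bool" where
  "module_basis M B \<longleftrightarrow> \<not> module.dependent (*s) B \<and> module.span (*s) B = M"

end

theory Submission
  imports Defs
begin

text \<open>
  Over a field, minimality forbids \<open>lm g\<close> to divide \<open>lm h\<close> for distinct \<open>g, h \<in> G\<close>. Two monomials
  in the same position always divide one another in one direction, so the leading monomials of
  \<open>G\<close> lie in pairwise distinct positions. Hence in \<open>\<Sum> a\<^sub>g g\<close> the leading monomials
  \<open>lm a\<^sub>g lm g\<close> of the nonzero summands are pairwise distinct and the largest one cannot cancel;
  this is the PLM property, and it forces linear independence. Spanning is the division algorithm,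
  which terminates because every monomial order is a well-order: there are finitely many positions,
  and within one position the order is the one of the exponents.
\<close>

section \<open>Monomials, coefficients and supports\<close>

lemma vmonom_in_monomials [simp]: "vmonom \<alpha> i \<in> monomials"
  by (auto simp: monomials_def)

lemma monomialsE:
  assumes "X \<in> monomials"
  obtains \<alpha> i where "X = vmonom \<alpha> i"
  using assms by (auto simp: monomials_def)

lemma monom_scale_vmonom [simp]:
  "monom 1 k *s (vmonom \<alpha> i :: 'a::comm_ring_1 poly ^ 'q) = vmonom (k + \<alpha>) i"
  by (simp add: vmonom_def vector_smult_assoc mult_monom)

lemma monomial_expansion_monomial_coeff: "monomial_expansion f (monomial_coeff f)"
  unfolding monomial_coeff_def by (rule theI'[OF monomial_expansion_unique])

abbreviation supp :: "'a::comm_ring_1 poly ^ 'q \<Rightarrow> ('a poly ^ 'q) set" where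
  "supp f \<equiv> {X. monomial_coeff f X \<noteq> 0}"

lemma finite_supp: "finite (supp f)"
  and supp_subset_monomials: "supp f \<subseteq> monomials"
  using monomial_expansion_monomial_coeff[of f] by (auto simp: monomial_expansion_def)

lemma supp_eq_empty_iff: "supp f = {} \<longleftrightarrow> f = 0"
proof
  assume "supp f = {}"
  then show "f = 0"
    using monomial_expansion_monomial_coeff[of f] by (simp add: monomial_expansion_def)
next
  assume "f = 0"
  then have "X \<notin> supp f" if "X \<in> monomials" for X
    using that by (auto elim!: monomialsE simp: monomial_coeff_vmonom)
  then show "supp f = {}" using supp_subset_monomials[of f] by blast
qed

lemma supp_nonzeroD:
  assumes "X \<in> supp f"
  shows "f \<noteq> 0"
  using assms supp_eq_empty_iff[of f] by (metis empty_iff)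

lemma supp_in_monomials: "X \<in> supp f \<Longrightarrow> X \<in> monomials"
  by (rule subsetD[OF supp_subset_monomials])

lemma monomial_coeff_sum:
  assumes "X \<in> monomials"
  shows "monomial_coeff (\<Sum>g\<in>F. h g) X = (\<Sum>g\<in>F. monomial_coeff (h g) X)"
  using assms by (auto elim!: monomialsE simp: monomial_coeff_vmonom coeff_sum)

lemma monomial_coeff_diff:
  assumes "X \<in> monomials"
  shows "monomial_coeff (f - g) X = monomial_coeff f X - monomial_coeff g X"
  using assms by (auto elim!: monomialsE simp: monomial_coeff_vmonom)

lemma monomial_coeff_scale_vmonom:
  "monomial_coeff (a *s f) (vmonom \<alpha> i) =
     (\<Sum>k\<le>\<alpha>. coeff a k * monomial_coeff f (vmonom (\<alpha> - k) i))"
  by (simp add: monomial_coeff_vmonom coeff_mult)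

section \<open>Monomial orders and leading monomials\<close>

text \<open>Coefficients lie in an integral domain, so that a product of leading coefficients is
  nonzero. Coefficients are first divided in \<open>groebner_basis_span\<close>, which is stated
  over a field.\<close>

locale monomial_ordering =
  fixes prec :: "'a::idom poly ^ 'q \<Rightarrow> 'a poly ^ 'q \<Rightarrow> bool"
  assumes order: "monomial_order prec"
begin

abbreviation preceq where "preceq X Y \<equiv> prec X Y \<or> X = Y"

lemma prec_irrefl: "X \<in> monomials \<Longrightarrow> \<not> prec X X"
  using order by (auto simp: monomial_order_def irreflp_on_def)

lemma prec_trans:
  assumes "prec X Y" "prec Y Z" "X \<in> monomials" "Y \<in> monomials" "Z \<in> monomials"
  shows "prec X Z"
  using order assms unfolding monomial_order_def by (blast dest: transp_onD)

lemma prec_total: "X \<in> monomials \<Longrightarrow> Y \<in> monomials \<Longrightarrow> X \<noteq> Y \<Longrightarrow> prec X Y \<or> prec Y X"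
  using order by (auto simp: monomial_order_def totalp_on_def)

text \<open>The axiom X < x^\<gamma> X enters here, with \<gamma> = \<beta> - \<alpha>: within one
  position, every monomial order is the order of the exponents.\<close>

lemma prec_vmonom_same:
  assumes "\<alpha> < \<beta>"
  shows "prec (vmonom \<alpha> i) (vmonom \<beta> i)"
proof -
  have "prec (vmonom \<alpha> i) (monom 1 (\<beta> - \<alpha>) *s vmonom \<alpha> i)"
    using order assms unfolding monomial_order_def
    by (metis vmonom_in_monomials One_nat_def Suc_leI zero_less_diff)
  then show ?thesis using assms by simp
qed

lemma prec_vmonom_shift:
  assumes "prec (vmonom \<alpha> i) (vmonom \<beta> j)"
  shows "prec (vmonom (k + \<alpha>) i) (vmonom (k + \<beta>) j)"
  using order assms unfolding monomial_order_def
  by (metis vmonom_in_monomials monom_scale_vmonom)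

lemma preceq_trans:
  assumes "preceq X Y" "preceq Y Z" "X \<in> monomials" "Y \<in> monomials" "Z \<in> monomials"
  shows "preceq X Z"
  using assms prec_trans[of X Y Z] by auto

lemma prec_preceq_False:
  assumes "prec X Y" "preceq Y X" "X \<in> monomials" "Y \<in> monomials"
  shows False
  using assms prec_trans[of X Y X] prec_irrefl[of X] by auto

lemma is_max_unique:
  assumes "is_max prec S X" "is_max prec S Y" "S \<subseteq> monomials"
  shows "X = Y"
proof (rule ccontr)
  assume ne: "X \<noteq> Y"
  have m: "X \<in> monomials" "Y \<in> monomials" using assms by (auto simp: is_max_def)
  have "prec X Y" "prec Y X" using assms ne by (auto simp: is_max_def)
  then show False using prec_trans prec_irrefl m by blast
qed

lemma is_max_exists:
  assumes "finite S" "S \<noteq> {}" "S \<subseteq> monomials"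
  shows "\<exists>X. is_max prec S X"
  using assms
proof (induction S rule: finite_ne_induct)
  case (singleton X)
  then show ?case by (auto simp: is_max_def)
next
  case (insert Z S)
  then obtain X where X: "is_max prec S X" by auto
  then have m: "X \<in> monomials" "Z \<in> monomials" "X \<noteq> Z" "X \<in> S"
    using insert by (auto simp: is_max_def)
  show ?case
  proof (cases "prec Z X")
    case True
    then show ?thesis using X by (auto simp: is_max_def)
  next
    case False
    then have "prec X Z" using prec_total m by blast
    then have "is_max prec (insert Z S) Z"
      using X insert.prems m prec_trans by (auto simp: is_max_def) (metis subsetD)
    then show ?thesis ..
  qed
qed

lemma is_max_supp_lm:
  assumes "f \<noteq> 0"
  shows "is_max prec (supp f) (lm prec f)"
proof -
  have "supp f \<noteq> {}" using assms by (simp only: supp_eq_empty_iff not_False_eq_True)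
  then obtain X where X: "is_max prec (supp f) X"
    using is_max_exists[OF finite_supp _ supp_subset_monomials] by blast
  then have "(THE X. is_max prec (supp f) X) = X"
    by (rule the_equality) (rule is_max_unique[OF _ X supp_subset_monomials])
  then show ?thesis using X unfolding lm_def by (simp only:)
qed

lemma lm_eqI:
  assumes "is_max prec (supp f) X"
  shows "lm prec f = X"
proof -
  have "X \<in> supp f" using assms by (simp only: is_max_def)
  then have "f \<noteq> 0" by (rule supp_nonzeroD)
  then show ?thesis using is_max_unique[OF is_max_supp_lm assms supp_subset_monomials] by simp
qed

lemma lm_in_supp: "f \<noteq> 0 \<Longrightarrow> lm prec f \<in> supp f"
  using is_max_supp_lm unfolding is_max_def by blast

lemma lm_in_monomials: "f \<noteq> 0 \<Longrightarrow> lm prec f \<in> monomials"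
  using lm_in_supp supp_subset_monomials by blast

lemma preceq_lm: "f \<noteq> 0 \<Longrightarrow> X \<in> supp f \<Longrightarrow> preceq X (lm prec f)"
  using is_max_supp_lm unfolding is_max_def by blast

text \<open>Leading monomials are multiplicative: in the convolution for the coefficient at the
  claimed maximum, only the product of the two leading coefficients survives.\<close>

lemma is_max_supp_scale:
  assumes a: "a \<noteq> 0" and f: "f \<noteq> 0"
  shows "is_max prec (supp (a *s f)) (poly_lm a *s lm prec f)"
proof -
  obtain \<beta> j where lmf: "lm prec f = vmonom \<beta> j"
    using lm_in_monomials[OF f] by (rule monomialsE)
  let ?d = "degree a"
  \<comment> \<open>The convolution pairs the coefficient of x^k in \<open>a\<close> with the
    exponent \<open>degree a + \<beta> - k\<close> in \<open>f\<close>. For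
    \<open>k < degree a\<close> that exponent exceeds \<beta>, so the monomial would lie above
    \<open>lm prec f\<close>.\<close>
  have high: "monomial_coeff f (vmonom (?d + \<beta> - k) j) = 0" if "k < ?d" for k
  proof (rule ccontr)
    assume nz: "\<not> ?thesis"
    have p: "prec (vmonom \<beta> j) (vmonom (?d + \<beta> - k) j)"
      by (rule prec_vmonom_same) (use that in simp)
    have "preceq (vmonom (?d + \<beta> - k) j) (vmonom \<beta> j)"
      using preceq_lm[OF f, of "vmonom (?d + \<beta> - k) j"] nz lmf by simp
    with p show False by (rule prec_preceq_False) simp_all
  qed
  have "monomial_coeff (a *s f) (vmonom (?d + \<beta>) j)
      = (\<Sum>k\<le>?d + \<beta>. if k = ?d then lead_coeff a * monomial_coeff f (vmonom \<beta> j) else 0)"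
    unfolding monomial_coeff_scale_vmonom
  proof (rule sum.cong[OF refl])
    fix k
    show "coeff a k * monomial_coeff f (vmonom (?d + \<beta> - k) j)
        = (if k = ?d then lead_coeff a * monomial_coeff f (vmonom \<beta> j) else 0)"
      using high[of k] by (cases k ?d rule: linorder_cases) (auto simp: coeff_eq_0)
  qed
  also have "\<dots> \<noteq> 0" using lm_in_supp[OF f] a lmf by simp
  finally have "vmonom (?d + \<beta>) j \<in> supp (a *s f)" by simp
  moreover have "preceq Y (vmonom (?d + \<beta>) j)" if Y: "Y \<in> supp (a *s f)" for Y
  proof -
    obtain \<alpha> i where Yv: "Y = vmonom \<alpha> i"
      using Y supp_subset_monomials by (blast elim: monomialsE)
    then have "(\<Sum>k\<le>\<alpha>. coeff a k * monomial_coeff f (vmonom (\<alpha> - k) i)) \<noteq> 0"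
      using Y by (simp add: monomial_coeff_scale_vmonom)
    then obtain k where k: "k \<le> \<alpha>" "coeff a k \<noteq> 0" "monomial_coeff f (vmonom (\<alpha> - k) i) \<noteq> 0"
      by (metis (no_types, lifting) atMost_iff mult_eq_0_iff sum.not_neutral_contains_not_neutral)
    \<comment> \<open>Y is x^k times a monomial of \<open>f\<close>, hence at most x^k lm(f); since
      \<open>k \<le> degree a\<close>, this in turn is at most x^(degree a) lm(f).\<close>
    have "preceq (vmonom (\<alpha> - k) i) (vmonom \<beta> j)" using preceq_lm[OF f, of "vmonom (\<alpha> - k) i"] k(3) lmf by simp
    then have 1: "preceq Y (vmonom (k + \<beta>) j)"
      using prec_vmonom_shift[of "\<alpha> - k" i \<beta> j k] k(1) Yv by auto
    have "k \<le> ?d" using k(2) by (rule le_degree)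
    then have 2: "preceq (vmonom (k + \<beta>) j) (vmonom (?d + \<beta>) j)"
      using prec_vmonom_same[of "k + \<beta>" "?d + \<beta>" j] by (cases "k = ?d") auto
    show ?thesis using 1 2 by (rule preceq_trans) (simp_all add: Yv)
  qed
  ultimately show ?thesis using lmf by (auto simp: is_max_def poly_lm_def)
qed

section \<open>Linear combinations of vectors with leading monomials in distinct positions\<close>

lemma poly_lm_scale_lm_in_monomials: "f \<noteq> 0 \<Longrightarrow> poly_lm a *s lm prec f \<in> monomials"
  using lm_in_monomials[of f] by (auto elim!: monomialsE simp: poly_lm_def)

text \<open>A single summand attains the maximum X of the scaled leading monomials, so its term at X
  cannot cancel. That the sum is nonzero is part of the conclusion, so the lemma serves both the PLM
  property and linear independence. The witness \<open>g0\<close> makes the set of scaled leading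
  monomials nonempty.\<close>

lemma is_max_linear_combination:
  assumes fin: "finite F" and nz: "0 \<notin> F"
    and pos: "\<And>g h \<alpha> \<beta> i. g \<in> F \<Longrightarrow> h \<in> F \<Longrightarrow> lm prec g = vmonom \<alpha> i \<Longrightarrow>
      lm prec h = vmonom \<beta> i \<Longrightarrow> g = h"
    and a: "g0 \<in> F" "a g0 \<noteq> 0"
  obtains X where "is_max prec (supp (\<Sum>g\<in>F. a g *s g)) X"
    and "is_max prec {poly_lm (a g) *s lm prec g | g. g \<in> F \<and> a g \<noteq> 0} X"
proof -
  let ?f = "\<Sum>g\<in>F. a g *s g" and ?p = "\<lambda>g. poly_lm (a g) *s lm prec g"
  let ?T = "{?p g | g. g \<in> F \<and> a g \<noteq> 0}"
  have mon: "?p g \<in> monomials" if "g \<in> F" for g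
    using that nz poly_lm_scale_lm_in_monomials by metis
  have T: "finite ?T" "?T \<noteq> {}" "?T \<subseteq> monomials" using fin a mon by auto
  obtain X where X: "is_max prec ?T X" using is_max_exists[OF T] by blast
  then obtain h where h: "X = ?p h" "h \<in> F" "a h \<noteq> 0" by (auto simp: is_max_def)
  have Xm: "X \<in> monomials" using mon h by blast
  have le: "preceq (?p g) X" if "g \<in> F" "a g \<noteq> 0" for g
    using X that by (auto simp: is_max_def)
  \<comment> \<open>Multiplication by \<open>poly_lm (a g)\<close> changes only the exponent of
    \<open>lm prec g\<close>. So \<open>?p g = ?p h\<close> puts both leading monomials in the same
    position, and \<open>pos\<close> applies.\<close>
  have inj: "g = h" if "g \<in> F" "?p g = X" for g
  proof -
    have "g \<noteq> 0" "h \<noteq> 0" using that h nz by auto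
    then obtain \<alpha> i \<beta> j where l: "lm prec g = vmonom \<alpha> i" "lm prec h = vmonom \<beta> j"
      using lm_in_monomials by (metis monomialsE)
    moreover have "i = j" using that(2) h(1) l by (simp add: poly_lm_def)
    ultimately show ?thesis using pos that h by blast
  qed
  have supp_le: "preceq Y (?p g)" if "g \<in> F" "Y \<in> supp (a g *s g)" for g Y
  proof -
    have "a g *s g \<noteq> 0" using that(2) by (rule supp_nonzeroD)
    then have "a g \<noteq> 0" "g \<noteq> 0" by auto
    then show ?thesis using is_max_supp_scale that(2) unfolding is_max_def by blast
  qed
  \<comment> \<open>If X occurred in \<open>a g *s g\<close>, it would be at most
    \<open>?p g\<close>. But \<open>?p g\<close> lies strictly below X, since only \<open>h\<close>
    attains the maximum.\<close>
  have other: "monomial_coeff (a g *s g) X = 0" if g: "g \<in> F" "g \<noteq> h" for g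
  proof (rule ccontr)
    assume c: "\<not> ?thesis"
    then have "a g *s g \<noteq> 0" using supp_nonzeroD[of X "a g *s g"] by simp
    then have ag: "a g \<noteq> 0" by auto
    have ne: "?p g \<noteq> X" using inj g by blast
    then have "prec X (?p g)" using supp_le[OF g(1), of X] c by auto
    moreover have "prec (?p g) X" using le[OF g(1) ag] ne by blast
    ultimately show False using prec_preceq_False Xm mon[OF g(1)] by blast
  qed
  have "monomial_coeff ?f X = (\<Sum>g\<in>F. if g = h then monomial_coeff (a h *s h) X else 0)"
    unfolding monomial_coeff_sum[OF Xm] by (rule sum.cong) (auto simp: other)
  also have "\<dots> = monomial_coeff (a h *s h) X" using fin h by simp
  also have "\<dots> \<noteq> 0"
    using is_max_supp_scale[of "a h" h] h nz unfolding is_max_def by auto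
  finally have "X \<in> supp ?f" by simp
  moreover have "preceq Y X" if Y: "Y \<in> supp ?f" for Y
  proof -
    have Ym: "Y \<in> monomials" using Y supp_subset_monomials by blast
    have "(\<Sum>g\<in>F. monomial_coeff (a g *s g) Y) \<noteq> 0"
      using Y by (simp add: monomial_coeff_sum[OF Ym])
    then obtain g where g: "g \<in> F" "monomial_coeff (a g *s g) Y \<noteq> 0"
      by (rule sum.not_neutral_contains_not_neutral)
    then have "a g *s g \<noteq> 0" using supp_nonzeroD[of Y "a g *s g"] by simp
    then have "a g \<noteq> 0" by auto
    then have "preceq (?p g) X" using le g by blast
    moreover have "preceq Y (?p g)" using supp_le g by blast
    ultimately show ?thesis using preceq_trans[of Y "?p g" X] Ym Xm mon[OF g(1)] by blast
  qed
  ultimately have "is_max prec (supp ?f) X" by (auto simp: is_max_def)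
  then show ?thesis using X by (rule that)
qed

section \<open>Well-foundedness of monomial orders\<close>

text \<open>In each position that occurs in \<open>S\<close>, only the monomial of least exponent
  can be minimal. The index type is finite, so finitely many candidates remain, and the least of
  them bounds all of \<open>S\<close>.\<close>

lemma prec_minimal_exists:
  assumes "S \<noteq> {}" "S \<subseteq> monomials"
  shows "\<exists>X\<in>S. \<forall>Y\<in>S. preceq X Y"
proof -
  let ?I = "{i. \<exists>\<alpha>. vmonom \<alpha> i \<in> S}"
  \<comment> \<open>The value \<open>m i\<close> is meaningful only for \<open>i \<in> ?I\<close>;
    elsewhere the \<open>LEAST\<close> is unspecified.\<close>
  define m where "m i = (LEAST \<alpha>. vmonom \<alpha> i \<in> S)" for i
  let ?T = "(\<lambda>i. vmonom (m i) i) ` ?I"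
  have m: "vmonom (m i) i \<in> S" if "i \<in> ?I" for i
    using that unfolding m_def by (auto intro: LeastI)
  have least: "preceq (vmonom (m i) i) (vmonom \<alpha> i)" if "vmonom \<alpha> i \<in> S" for \<alpha> i
  proof -
    have "m i \<le> \<alpha>" unfolding m_def using that by (rule Least_le)
    then show ?thesis using prec_vmonom_same[of "m i" \<alpha> i] by (cases "m i = \<alpha>") auto
  qed
  have finite_min: "\<exists>X\<in>A. \<forall>Y\<in>A. preceq X Y" if "finite A" "A \<noteq> {}" "A \<subseteq> monomials" for A
    using that
  proof (induction A rule: finite_ne_induct)
    case (insert Z A)
    then obtain X where X: "X \<in> A" "\<forall>Y\<in>A. preceq X Y" by auto
    show ?case
    proof (cases "prec Z X")
      case True
      have "preceq Z Y" if "Y \<in> A" for Y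
        using preceq_trans[of Z X Y] X that True insert.prems by blast
      then show ?thesis by auto
    next
      case False
      then have "preceq X Z" using prec_total X insert.prems by auto
      then show ?thesis using X by auto
    qed
  qed simp
  have "?T \<noteq> {}"
  proof -
    obtain X where "X \<in> S" using assms by blast
    moreover then obtain \<alpha> i where "X = vmonom \<alpha> i" using assms by (blast elim: monomialsE)
    ultimately show ?thesis by blast
  qed
  moreover have "finite ?T" "?T \<subseteq> monomials" by auto
  ultimately have "\<exists>X\<in>?T. \<forall>Y\<in>?T. preceq X Y" by (intro finite_min)
  then obtain X where X: "X \<in> ?T" "\<forall>Y\<in>?T. preceq X Y" by (rule bexE)
  have "preceq X Y" if Y: "Y \<in> S" for Y
  proof -
    obtain \<alpha> i where Yv: "Y = vmonom \<alpha> i" using Y assms by (blast elim: monomialsE)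
    then have "vmonom (m i) i \<in> ?T" using Y by blast
    with X(2) have "preceq X (vmonom (m i) i)" by (rule bspec)
    moreover have "preceq (vmonom (m i) i) Y" using least Y Yv by blast
    ultimately show ?thesis by (rule preceq_trans) (use X Yv in auto)
  qed
  moreover have "X \<in> S" using X m by auto
  ultimately show ?thesis by (intro bexI[of _ X] ballI)
qed

section \<open>Leading term modules and division\<close>

lemma lt_eq_monom_axis:
  assumes "lm prec f = vmonom \<alpha> i"
  shows "lt prec f = monom (monomial_coeff f (lm prec f)) \<alpha> *s axis i 1"
  using assms by (simp add: lt_def vmonom_def vector_smult_assoc smult_monom)

text \<open>Write \<open>lt prec f\<close> as a polynomial combination of leading terms from
  \<open>G\<close> and compare coefficients at x^\<beta> e_i. Some summand contributes there. Each
  \<open>lt prec g\<close> is a single term, so a contributing one sits in position \<open>i\<close>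
  with exponent at most \<beta>.\<close>

lemma lt_module_divides:
  assumes fin: "finite G" and nz: "0 \<notin> G" and f: "f \<noteq> 0"
    and mem: "lt prec f \<in> lt_module prec G" and lmf: "lm prec f = vmonom \<beta> i"
  obtains g \<alpha> where "g \<in> G" "lm prec g = vmonom \<alpha> i" "\<alpha> \<le> \<beta>"
proof -
  interpret module "(*s) :: 'a poly \<Rightarrow> 'a poly ^ 'q \<Rightarrow> 'a poly ^ 'q" by (rule module_poly_vec)
  have "lt prec f \<in> span (lt prec ` G)" using mem nz by (simp add: lt_module_def)
  moreover have "finite (lt prec ` G)" using fin by simp
  ultimately obtain u where u: "lt prec f = (\<Sum>v\<in>lt prec ` G. u v *s v)"
    using span_finite by blast
  have "coeff (lt prec f $ i) \<beta> \<noteq> 0"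
    using lm_in_supp[OF f] unfolding lt_eq_monom_axis[OF lmf] by (simp add: axis_def)
  then have "(\<Sum>v\<in>lt prec ` G. coeff ((u v *s v) $ i) \<beta>) \<noteq> 0"
    by (subst (asm) u) (simp add: coeff_sum)
  then obtain v where "v \<in> lt prec ` G" "coeff ((u v *s v) $ i) \<beta> \<noteq> 0"
    by (rule sum.not_neutral_contains_not_neutral)
  then obtain g where g: "g \<in> G" "coeff ((u (lt prec g) *s lt prec g) $ i) \<beta> \<noteq> 0"
    by blast
  obtain \<alpha> j where l: "lm prec g = vmonom \<alpha> j"
    using lm_in_monomials g nz by (metis monomialsE)
  have "lt prec g $ i = (if j = i then monom (monomial_coeff g (lm prec g)) \<alpha> else 0)"
    unfolding lt_eq_monom_axis[OF l] by (simp add: axis_def)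
  moreover have "coeff (lt prec g $ i * u (lt prec g)) \<beta> \<noteq> 0"
    using g(2) by (simp add: mult.commute)
  ultimately have "j = i" "\<alpha> \<le> \<beta>"
    by (auto simp: coeff_monom_mult split: if_splits)
  then show ?thesis using that g(1) l by blast
qed

end

text \<open>The division algorithm as a minimal counterexample: among the elements of
  \<open>M\<close> outside \<open>span G\<close>, one with smallest leading monomial is reduced once
  by an element of \<open>G\<close>, which yields a smaller one.\<close>

lemma groebner_basis_span:
  fixes prec :: "'a::field poly ^ 'q \<Rightarrow> 'a poly ^ 'q \<Rightarrow> bool"
  assumes ord: "monomial_order prec" and sub: "module.subspace (*s) M"
    and gb: "groebner_basis prec M G"
  shows "module.span (*s) G = M"
proof -
  interpret module "(*s) :: 'a poly \<Rightarrow> 'a poly ^ 'q \<Rightarrow> 'a poly ^ 'q" by (rule module_poly_vec)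
  interpret monomial_ordering prec by unfold_locales (rule ord)
  have G: "finite G" "G \<subseteq> M" "0 \<notin> G" "lt_module prec G = lt_module prec M"
    using gb by (auto simp: groebner_basis_def)
  have "M \<subseteq> span G"
  proof (rule ccontr)
    assume "\<not> M \<subseteq> span G"
    let ?B = "M - span G"
    have nz: "f \<noteq> 0" if "f \<in> ?B" for f using that span_zero by auto
    have "lm prec ` ?B \<noteq> {}" "lm prec ` ?B \<subseteq> monomials"
      using \<open>\<not> M \<subseteq> span G\<close> nz lm_in_monomials by auto
    then have "\<exists>X\<in>lm prec ` ?B. \<forall>Y\<in>lm prec ` ?B. preceq X Y" by (rule prec_minimal_exists)
    then obtain X where X: "X \<in> lm prec ` ?B" "\<forall>Y\<in>lm prec ` ?B. preceq X Y" by (rule bexE)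
    then obtain f where f: "f \<in> ?B" "X = lm prec f" by blast
    obtain \<beta> i where lmf: "lm prec f = vmonom \<beta> i"
      using lm_in_monomials[OF nz[OF f(1)]] by (rule monomialsE)
    have "lt prec f \<in> lt_module prec G"
      unfolding G(4) unfolding lt_module_def using f nz by (intro span_base) auto
    then obtain g \<alpha> where g: "g \<in> G" "lm prec g = vmonom \<alpha> i" "\<alpha> \<le> \<beta>"
      using lt_module_divides[OF G(1,3) nz[OF f(1)] _ lmf] by blast
    have gnz: "g \<noteq> 0" using g G by auto
    let ?cg = "monomial_coeff g (vmonom \<alpha> i)" and ?cf = "monomial_coeff f (vmonom \<beta> i)"
    have cnz: "?cg \<noteq> 0" "?cf \<noteq> 0"
      using lm_in_supp[OF gnz] lm_in_supp[OF nz[OF f(1)]] g lmf by auto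
    \<comment> \<open>The single term for which \<open>a *s g\<close> has the same leading monomial
      and leading coefficient as \<open>f\<close>.\<close>
    define a where "a = monom (?cf / ?cg) (\<beta> - \<alpha>)"
    have anz: "a \<noteq> 0" using cnz by (simp add: a_def)
    have "degree a = \<beta> - \<alpha>" using cnz by (simp add: a_def degree_monom_eq)
    then have maxag: "is_max prec (supp (a *s g)) (vmonom \<beta> i)"
      using is_max_supp_scale[OF anz gnz] g by (simp add: poly_lm_def)
    let ?h = "f - a *s g"
    have ag: "a *s g \<in> span G" using g by (intro span_scale span_base)
    have "?h \<in> M" using f g G sub by (auto intro: subspace_diff subspace_scale)
    moreover have "?h \<notin> span G"
      \<comment> \<open>Otherwise \<open>f = ?h + a *s g\<close> would lie in
        \<open>span G\<close>.\<close>
      using ag f span_add[of ?h G "a *s g"] by auto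
    ultimately have h: "?h \<in> ?B" by blast
    let ?Y = "lm prec ?h"
    have Ys: "?Y \<in> supp ?h" using lm_in_supp[OF nz[OF h]] .
    have Ym: "?Y \<in> monomials" using lm_in_monomials[OF nz[OF h]] .
    have "monomial_coeff (a *s g) (vmonom \<beta> i) = ?cf"
      using cnz g(3)
      by (simp add: monomial_coeff_vmonom a_def coeff_monom_mult)
    then have "monomial_coeff ?h (vmonom \<beta> i) = 0" by (simp add: monomial_coeff_diff)
    then have ne: "?Y \<noteq> vmonom \<beta> i" using Ys by auto
    \<comment> \<open>Subtraction creates no new monomials, so \<open>?Y\<close> is at most
      x^\<beta> e_i, and the cancellation at x^\<beta> e_i makes this strict. That contradicts the
      choice of \<open>f\<close>.\<close>
    have "?Y \<in> supp f \<or> ?Y \<in> supp (a *s g)"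
      using Ys by (auto simp: monomial_coeff_diff[OF Ym])
    then have "prec ?Y (vmonom \<beta> i)"
      using preceq_lm[OF nz[OF f(1)], of ?Y] lmf maxag ne unfolding is_max_def by auto
    moreover have "preceq (vmonom \<beta> i) ?Y" using X(2) f(2) lmf h by auto
    ultimately show False using prec_preceq_False Ym vmonom_in_monomials by blast
  qed
  moreover have "span G \<subseteq> M" using G sub by (intro span_minimal)
  ultimately show ?thesis by blast
qed

section \<open>Consequences of minimality\<close>

text \<open>Over a field the quotient of the leading coefficients exists, so one summand
  (\<open>s = 1\<close>) already expresses \<open>lt prec f\<close>.\<close>

lemma reducible_modulo_of_lm_dvd:
  fixes prec :: "'a::field poly ^ 'q \<Rightarrow> 'a poly ^ 'q \<Rightarrow> bool"
  assumes ord: "monomial_order prec"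
    and g: "g \<in> F" "g \<noteq> 0" and l: "lm prec f = vmonom \<beta> i" "lm prec g = vmonom \<alpha> i" "\<alpha> \<le> \<beta>"
  shows "reducible_modulo prec F f"
proof -
  interpret monomial_ordering prec by unfold_locales (rule ord)
  let ?cg = "monomial_coeff g (lm prec g)" and ?cf = "monomial_coeff f (lm prec f)"
  have "?cg \<noteq> 0" using lm_in_supp[OF g(2)] by simp
  then have "lt prec f = ([:?cf / ?cg:] * monom 1 (\<beta> - \<alpha>)) *s lt prec g"
    unfolding lt_eq_monom_axis[OF l(1)] lt_eq_monom_axis[OF l(2)]
    using l(3) by (simp add: vector_smult_assoc smult_monom mult_monom)
  then show ?thesis
    unfolding reducible_modulo_def using g l
    by (intro exI[of _ 1] exI[of _ "\<lambda>_. g"] exI[of _ "\<lambda>_. \<beta> - \<alpha>"] exI[of _ "\<lambda>_. ?cf / ?cg"]) auto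
qed

text \<open>Exponents in one position are comparable, so one of two distinct elements would be
  reducible modulo the rest of \<open>G\<close>. This supplies the hypothesis \<open>pos\<close> of
  \<open>is_max_linear_combination\<close>.\<close>

lemma minimal_groebner_basis_positions:
  fixes prec :: "'a::field poly ^ 'q \<Rightarrow> 'a poly ^ 'q \<Rightarrow> bool"
  assumes ord: "monomial_order prec" and min: "minimal_groebner_basis prec M G"
    and gh: "g \<in> G" "h \<in> G" "lm prec g = vmonom \<alpha> i" "lm prec h = vmonom \<beta> i"
  shows "g = h"
proof (rule ccontr)
  assume "g \<noteq> h"
  have "g \<noteq> 0" "h \<noteq> 0"
    using min gh by (auto simp: minimal_groebner_basis_def groebner_basis_def)
  then have "reducible_modulo prec (G - {g}) g \<or> reducible_modulo prec (G - {h}) h"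
    using reducible_modulo_of_lm_dvd[OF ord] gh \<open>g \<noteq> h\<close>
    by (metis Diff_iff nat_le_linear singletonD)
  then show False
    using min gh by (auto simp: minimal_groebner_basis_def minimal_wrt_def)
qed

theorem theorem3p2:
  fixes prec :: "'a::field poly ^ 'q \<Rightarrow> 'a poly ^ 'q \<Rightarrow> bool"
    and M G :: "('a poly ^ 'q) set"
  assumes "monomial_order prec"
    and "module.subspace (*s) M"
    and "M \<noteq> {0}"
    and "minimal_groebner_basis prec M G"
  shows "plm_property prec M G \<and> module_basis M G"
proof -
  interpret module "(*s) :: 'a poly \<Rightarrow> 'a poly ^ 'q \<Rightarrow> 'a poly ^ 'q" by (rule module_poly_vec)
  interpret monomial_ordering prec by unfold_locales (rule assms(1))
  have gb: "groebner_basis prec M G" using assms(4) by (simp add: minimal_groebner_basis_def)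
  then have G: "finite G" "G \<subseteq> M" "0 \<notin> G" by (auto simp: groebner_basis_def)
  have span: "span G = M" using groebner_basis_span[OF assms(1,2) gb] .
  \<comment> \<open>The empty set spans only {0}; this is where \<open>M\<close> being nonzero is
    used.\<close>
  then have "G \<noteq> {}" using assms(3) by auto
  have comb: "\<exists>X. is_max prec (supp (\<Sum>g\<in>G. a g *s g)) X \<and>
      is_max prec {poly_lm (a g) *s lm prec g | g. g \<in> G \<and> a g \<noteq> 0} X"
    if "g0 \<in> G" "a g0 \<noteq> 0" for a g0
  proof (rule is_max_linear_combination[where F = G and a = a and ?g0.0 = g0])
    show "g = h" if "g \<in> G" "h \<in> G" "lm prec g = vmonom \<alpha> i" "lm prec h = vmonom \<beta> i"
      for g h \<alpha> \<beta> i
      using that by (rule minimal_groebner_basis_positions[OF assms(1,4)])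
  qed (use G that in auto)
  have "plm_property prec M G"
    unfolding plm_property_def
  proof (intro conjI ballI allI impI)
    fix f a assume "f \<in> M" and "f \<noteq> 0 \<and> f = (\<Sum>g\<in>G. a g *s g)"
    then have fa: "f \<noteq> 0" "f = (\<Sum>g\<in>G. a g *s g)" by blast+
    \<comment> \<open>A nonzero sum has a nonzero summand, which provides the nonzero coefficient
      that \<open>comb\<close> asks for.\<close>
    have "(\<Sum>g\<in>G. a g *s g) \<noteq> 0" using fa(1) unfolding fa(2) .
    then obtain g0 where "g0 \<in> G" "a g0 *s g0 \<noteq> 0"
      by (rule sum.not_neutral_contains_not_neutral)
    then have g0: "g0 \<in> G" "a g0 \<noteq> 0" by auto
    obtain X where X: "is_max prec (supp f) X"
      "is_max prec {poly_lm (a g) *s lm prec g | g. g \<in> G \<and> a g \<noteq> 0} X"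
      using comb[of g0 a, OF g0] unfolding fa(2) by blast
    \<comment> \<open>The same X is the largest monomial of \<open>f\<close>, hence
      \<open>lm prec f\<close>, and the largest scaled leading monomial.\<close>
    then show "is_max prec {poly_lm (a g) *s lm prec g | g. g \<in> G \<and> a g \<noteq> 0} (lm prec f)"
      using lm_eqI[OF X(1)] by simp
  qed (use G \<open>G \<noteq> {}\<close> in auto)
  moreover have "\<not> module.dependent (*s) G"
  proof
    assume "module.dependent (*s) G"
    then obtain a g where g: "g \<in> G" "a g \<noteq> 0" and sum: "(\<Sum>x\<in>G. a x *s x) = 0"
      using dependent_finite[OF G(1)] by blast
    \<comment> \<open>By \<open>comb\<close>, a combination with a nonzero coefficient contains some
      monomial, so the relation cannot sum to 0.\<close>
    obtain X where "is_max prec (supp (\<Sum>x\<in>G. a x *s x)) X"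
      using comb[of g a, OF g] by blast
    then have "X \<in> supp (\<Sum>x\<in>G. a x *s x)" by (simp only: is_max_def)
    from supp_nonzeroD[OF this] show False using sum by (rule notE)
  qed
  ultimately show ?thesis using span by (simp add: module_basis_def)
qed

end
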